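(* Let $A$ be an $n\times m$ complex matrix, $X$ an $n\times p$ complex matrix, $Y$ an $m\times q$ complex matrix, and let $$M = A^{\dagger} - A^{\dagger} X (Y^{*} A^{\dagger} X)^{\dagger} Y^{*} A^{\dagger}.$$ Put $\hat{\mathcal X}=\ker(M)\subseteq\mathbb C^n$ and $\hat{\mathcal Y}=\operatorname{im}(M)^{\perp}\subseteq\mathbb C^m$, and let $\hat X,\hat Y$ be any matrices with $\operatorname{im}(\hat X)=\hat{\mathcal X}$ and $\operatorname{im}(\hat Y)=\hat{\mathcal Y}$. Then the Moore-Penrose inverse of $M$ is $$M^{\dagger}=P_{\hat{\mathcal X}^{\perp}}\,A\,P_{\hat{\mathcal Y}^{\perp}},$$ where the orthogonal projection matrices onto $\hat{\mathcal X}^{\perp}$ and $\hat{\mathcal Y}^{\perp}$ are given by $$P_{\hat{\mathcal X}^{\perp}}=I-\hat X(\hat X^{*}\hat X)^{\dagger}\hat X^{*},\qquad P_{\hat{\mathcal Y}^{\perp}}=I-\hat Y(\hat Y^{*}\hat Y)^{\dagger}\hat Y^{*}.$$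
   Context: $(\cdot)^{\dagger}$ is the Moore-Penrose pseudo-inverse, $(\cdot)^{*}$ the conjugate transpose, $(\cdot)^{\perp}$ the orthogonal complement. $P_{\mathcal R}$ denotes the orthogonal projection matrix onto the subspace $\mathcal R$. *)

theory Defs
  imports
    "Jordan_Normal_Form.Matrix_Kernel"
    "Jordan_Normal_Form.Schur_Decomposition"
begin

definition mat_image :: "'a :: comm_ring_1 mat \<Rightarrow> 'a vec set" where
  "mat_image A = {A *\<^sub>v v | v. v \<in> carrier_vec (dim_col A)}"

(* The library's orthogonal_complement uses the bilinear form, without conjugation;
   over the complex numbers the Hermitian inner product is needed. *)
definition herm_complement :: "nat \<Rightarrow> complex vec set \<Rightarrow> complex vec set" where
  "herm_complement n S = {v \<in> carrier_vec n. \<forall>w \<in> S. v \<bullet>c w = 0}"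

definition is_pinv :: "complex mat \<Rightarrow> complex mat \<Rightarrow> bool" where
  "is_pinv A B \<longleftrightarrow>
     B \<in> carrier_mat (dim_col A) (dim_row A) \<and>
     A * B * A = A \<and> B * A * B = B \<and>
     mat_adjoint (A * B) = A * B \<and> mat_adjoint (B * A) = B * A"

definition pinv :: "complex mat \<Rightarrow> complex mat" where
  "pinv A = (THE B. is_pinv A B)"

definition is_orth_proj :: "nat \<Rightarrow> complex vec set \<Rightarrow> complex mat \<Rightarrow> bool" where
  "is_orth_proj n R P \<longleftrightarrow>
     P \<in> carrier_mat n n \<and>
     (\<forall>v \<in> carrier_vec n. P *\<^sub>v v \<in> R \<and> v - P *\<^sub>v v \<in> herm_complement n R)"

(* Meaningful for R a linear subspace of the n-dimensional complex space. *)
definition orth_proj :: "nat \<Rightarrow> complex vec set \<Rightarrow> complex mat" where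
  "orth_proj n R = (THE P. is_orth_proj n R P)"

end

(* Pseudo-inverses exist because an inner inverse G of A'A (A' the adjoint, G from Gauss-Jordan elimination)
   makes A G A' the orthogonal projection onto im A; with the analogous inner inverse F of AA',
   the matrix A'F A GA' satisfies the four Penrose equations.  For the theorem, expanding
   gives M A M = M, and M^+ M and M M^+ are the orthogonal projections onto ker(M)^perp and im(M),
   so the claimed product is M^+ (M A M) M^+ = M^+ M M^+ = M^+. *)

theory Submission
  imports Defs
begin

section \<open>Inner inverses over a field by row reduction\<close>

text \<open>Side conditions are bare dimension equations, so the simplifier can rewrite every
  product to right-nested form without first guessing the carriers.\<close>

lemma mult_mat_assoc:
  fixes A B C :: "'a :: semiring_0 mat"
  assumes "dim_col A = dim_row B" "dim_col B = dim_row C"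
  shows "A * B * C = A * (B * C)"
  by (rule assoc_mult_mat[of A "dim_row A" "dim_col A" B "dim_col B" C "dim_col C"])
    (use assms in \<open>simp_all only: carrier_mat_def mem_Collect_eq simp_thms\<close>)

text \<open>The pivot columns of a reduced echelon form are unit vectors, so a matrix
  \<open>G\<close> selecting them makes \<open>C * G\<close> the diagonal 0-1 matrix of the nonzero
  rows, which leaves \<open>C\<close> unchanged.\<close>

lemma row_echelon_form_inner_inverse:
  fixes C :: "'a :: field mat"
  assumes C: "C \<in> carrier_mat nr nc" and ref: "row_echelon_form C"
  shows "\<exists>G \<in> carrier_mat nc nr. C * G * C = C"
proof -
  from ref C obtain f where f: "pivot_fun C f nc"
    unfolding row_echelon_form_def by auto
  have dim: "dim_row C = nr" "dim_col C = nc" using C by auto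
  note p = pivot_funD[OF dim(1) f]
  \<comment> \<open>Column \<open>i\<close> of \<open>G\<close> is the unit vector at the pivot
    position of row \<open>i\<close>. The value \<open>f i = nc\<close> marks a zero row; no
    \<open>j\<close> reaches it, so that column is zero.\<close>
  define G :: "'a mat" where "G = mat nc nr (\<lambda>(j, i). if j = f i then 1 else 0)"
  have G: "G \<in> carrier_mat nc nr" by (simp add: G_def)
  have CG: "C * G = mat_diag nr (\<lambda>i. if f i < nc then 1 else 0)"
  proof (rule eq_matI)
    fix a i assume "a < dim_row (mat_diag nr (\<lambda>i. if f i < nc then 1 else 0 :: 'a))"
      and "i < dim_col (mat_diag nr (\<lambda>i. if f i < nc then 1 else 0 :: 'a))"
    then have ai: "a < nr" "i < nr" by (auto simp: mat_diag_def)
    have "(C * G) $$ (a, i) = (\<Sum>j = 0..<nc. C $$ (a, j) * (if j = f i then 1 else 0))"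
      using ai dim by (simp add: G_def scalar_prod_def)
    also have "\<dots> = (\<Sum>j = 0..<nc. if j = f i then C $$ (a, j) else 0)"
      by (rule sum.cong) auto
    also have "\<dots> = (if f i < nc then C $$ (a, f i) else 0)"
      by simp
    also have "\<dots> = (if a = i then if f i < nc then 1 else 0 else 0)"
      using p(4)[OF ai(2)] p(5)[OF ai(2) _ ai(1)] by auto
    finally show "(C * G) $$ (a, i) = mat_diag nr (\<lambda>i. if f i < nc then 1 else 0) $$ (a, i)"
      using ai by (auto simp: mat_diag_def)
  qed (use dim G in \<open>auto simp: mat_diag_def\<close>)
  have "C * G * C = C"
    unfolding CG mat_diag_mult_left[OF C]
  proof (rule eq_matI)
    fix i j assume ij: "i < dim_row C" "j < dim_col C"
    \<comment> \<open>A row without pivot vanishes, since all its entries lie to the left of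
      \<open>f i = nc\<close>.\<close>
    then have "f i < nc \<or> C $$ (i, j) = 0"
      using p(1)[of i] p(2)[of i j] dim by force
    then show "mat nr nc (\<lambda>(i, j). (if f i < nc then 1 else 0) * C $$ (i, j)) $$ (i, j) = C $$ (i, j)"
      using ij dim by auto
  qed (use dim in auto)
  with G show ?thesis by blast
qed

text \<open>Row reduction gives \<open>C = P * A\<close> with \<open>P\<close> invertible. If
  \<open>G\<close> is an inner inverse of \<open>C\<close>, then
  \<open>A * G * P * A = Q * C * G * C = Q * C = A\<close>.\<close>

lemma inner_inverse_exists:
  fixes A :: "'a :: field mat"
  assumes A: "A \<in> carrier_mat nr nc"
  shows "\<exists>G \<in> carrier_mat nc nr. A * G * A = A"
proof -
  define C where "C = gauss_jordan_single A"
  note gj = gauss_jordan_single[OF A C_def[symmetric]]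
  from gj(4) obtain P Q where PQ: "C = P * A" "P \<in> carrier_mat nr nr" "Q \<in> carrier_mat nr nr"
    "Q * P = 1\<^sub>m nr" by blast
  from row_echelon_form_inner_inverse[OF gj(2,3)]
  obtain G where G: "G \<in> carrier_mat nc nr" "C * G * C = C" by blast
  have "Q * C = (Q * P) * A"
    unfolding PQ(1) using A PQ(2,3) by (simp add: mult_mat_assoc)
  then have QC: "Q * C = A" using A by (simp add: PQ(4))
  have "A * (G * P) * A = (Q * C) * (G * P) * A" by (simp add: QC)
  also have "\<dots> = Q * (C * G * (P * A))"
    using A PQ(2,3) G gj(2) by (simp add: mult_mat_assoc)
  also have "\<dots> = A"
    using G(2) QC by (simp add: PQ(1)[symmetric])
  finally show ?thesis
    using G PQ(2) by (intro bexI[of _ "G * P"]) auto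
qed

section \<open>Adjoints, the Hermitian inner product and cancellation\<close>

lemma dim_mat_adjoint [simp]:
  "dim_row (mat_adjoint A) = dim_col A" "dim_col (mat_adjoint A) = dim_row A"
  by (simp_all add: mat_adjoint_def)

lemma mat_adjoint_carrier [simp]:
  "mat_adjoint A \<in> carrier_mat n m \<longleftrightarrow> A \<in> carrier_mat m n"
  unfolding carrier_mat_def mem_Collect_eq dim_mat_adjoint by (rule conj_commute)

lemma index_mat_adjoint [simp]:
  "i < dim_col A \<Longrightarrow> j < dim_row A \<Longrightarrow> mat_adjoint A $$ (i, j) = conjugate (A $$ (j, i))"
  by (simp add: mat_adjoint_def mat_of_rows_index)

lemma mat_adjoint_adjoint [simp]: "mat_adjoint (mat_adjoint A) = A"
  by (rule eq_matI) auto

lemma mat_adjoint_mult: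
  fixes A B :: "'a :: conjugatable_field mat"
  assumes "dim_col A = dim_row B"
  shows "mat_adjoint (A * B) = mat_adjoint B * mat_adjoint A"
proof (rule eq_matI)
  fix i j assume "i < dim_row (mat_adjoint B * mat_adjoint A)"
    and "j < dim_col (mat_adjoint B * mat_adjoint A)"
  then have ij: "i < dim_col B" "j < dim_row A" by auto
  have "mat_adjoint (A * B) $$ (i, j) = conjugate (\<Sum>k = 0..<dim_row B. A $$ (j, k) * B $$ (k, i))"
    using assms ij by (simp add: scalar_prod_def)
  also have "\<dots> = (\<Sum>k = 0..<dim_row B. conjugate (A $$ (j, k) * B $$ (k, i)))"
    by (rule sum_conjugate) simp
  also have "\<dots> = (\<Sum>k = 0..<dim_row B. conjugate (B $$ (k, i)) * conjugate (A $$ (j, k)))"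
    by (simp add: conjugate_dist_mul mult.commute)
  also have "\<dots> = (mat_adjoint B * mat_adjoint A) $$ (i, j)"
    using assms ij by (simp add: scalar_prod_def)
  finally show "mat_adjoint (A * B) $$ (i, j) = (mat_adjoint B * mat_adjoint A) $$ (i, j)" .
qed auto

lemma cscalar_prod_zero_sym:
  fixes v w :: "'a :: {conjugatable_ring, comm_ring} vec"
  assumes v: "v \<in> carrier_vec n" and w: "w \<in> carrier_vec n" and 0: "v \<bullet>c w = 0"
  shows "w \<bullet>c v = 0"
proof -
  have "w \<bullet>c v = conjugate v \<bullet> w" by (rule conjugate_vec_sprod_comm[OF w v])
  also have "\<dots> = conjugate (v \<bullet>c w)"
    using v w by (simp add: conjugate_sprod_vec[of _ n])
  finally show ?thesis by (simp add: 0)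
qed

lemma cscalar_prod_mult_mat_vec:
  fixes A :: "'a :: conjugatable_field mat"
  assumes "A \<in> carrier_mat n m" "v \<in> carrier_vec m" "w \<in> carrier_vec n"
  shows "(A *\<^sub>v v) \<bullet>c w = v \<bullet>c (mat_adjoint A *\<^sub>v w)"
proof -
  have dims: "dim_row A = n" "dim_col A = m" "dim_vec v = m" "dim_vec w = n"
    using assms by auto
  have "(A *\<^sub>v v) \<bullet>c w = (\<Sum>i = 0..<n. (\<Sum>j = 0..<m. A $$ (i, j) * v $ j) * conjugate (w $ i))"
    using dims by (simp add: scalar_prod_def)
  also have "\<dots> = (\<Sum>i = 0..<n. \<Sum>j = 0..<m. A $$ (i, j) * v $ j * conjugate (w $ i))"
    by (simp add: sum_distrib_right)
  also have "\<dots> = (\<Sum>j = 0..<m. \<Sum>i = 0..<n. A $$ (i, j) * v $ j * conjugate (w $ i))"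
    by (rule sum.swap)
  also have "\<dots> = (\<Sum>j = 0..<m. v $ j * (\<Sum>i = 0..<n. A $$ (i, j) * conjugate (w $ i)))"
    by (simp only: sum_distrib_left mult_ac)
  also have "\<dots> = (\<Sum>j = 0..<m. v $ j * conjugate (\<Sum>i = 0..<n. conjugate (A $$ (i, j)) * w $ i))"
    by (simp add: sum_conjugate conjugate_dist_mul)
  also have "\<dots> = v \<bullet>c (mat_adjoint A *\<^sub>v w)"
    using dims by (simp add: scalar_prod_def)
  finally show ?thesis .
qed

text \<open>The diagonal entries of E'E are the squared norms of the columns of
  \<open>E\<close>.\<close>

lemma mat_adjoint_mult_self_eq_zero:
  fixes E :: "complex mat"
  assumes E: "E \<in> carrier_mat n m" and 0: "mat_adjoint E * E = 0\<^sub>m m m"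
  shows "E = 0\<^sub>m n m"
proof (rule eq_matI)
  fix i j assume "i < dim_row (0\<^sub>m n m :: complex mat)" "j < dim_col (0\<^sub>m n m :: complex mat)"
  then have ij: "i < n" "j < m" by auto
  have "col E j \<bullet>c col E j = (mat_adjoint E * E) $$ (j, j)"
    using E ij by (auto simp: scalar_prod_def mult.commute intro!: sum.cong)
  also have "\<dots> = 0" using 0 ij by simp
  finally have "col E j = 0\<^sub>v n"
    using E ij by (subst (asm) conjugate_square_eq_0_vec[of _ n]) auto
  then have "col E j $ i = 0\<^sub>v n $ i" by simp
  then show "E $$ (i, j) = 0\<^sub>m n m $$ (i, j)"
    using E ij by simp
qed (use E in auto)

text \<open>For E = A(K - L) the hypothesis says A'E = 0, hence E'E = (K - L)'A'E = 0 and so E =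
  0.\<close>

lemma mat_adjoint_cancel:
  fixes A :: "complex mat"
  assumes A: "A \<in> carrier_mat n m" and K: "K \<in> carrier_mat m k" and L: "L \<in> carrier_mat m k"
    and eq: "mat_adjoint A * (A * K) = mat_adjoint A * (A * L)"
  shows "A * K = A * L"
proof -
  define E where "E = A * (K - L)"
  have E: "E \<in> carrier_mat n k"
    unfolding E_def using A L by (intro carrier_matI) auto
  have "mat_adjoint E * E = mat_adjoint (K - L) * (mat_adjoint A * E)"
    using A K L by (simp add: E_def mat_adjoint_mult mult_mat_assoc)
  also have "mat_adjoint A * E = mat_adjoint A * (A * K) - mat_adjoint A * (A * L)"
    using A K L by (simp add: E_def mult_minus_distrib_mat[of _ _ m _ k]  mult_minus_distrib_mat[of _ _ n _ k])
  also have "\<dots> = 0\<^sub>m m k" using A K L by (simp add: eq minus_r_inv_mat[of _ m k])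
  finally have "mat_adjoint E * E = 0\<^sub>m k k" using K L by (simp add: minus_mat_def)
  from mat_adjoint_mult_self_eq_zero[OF E this]
  have "A * K - A * L = 0\<^sub>m n k"
    using A K L by (simp add: E_def mult_minus_distrib_mat[of _ _ m _ k])
  then have "\<And>i j. i < n \<Longrightarrow> j < k \<Longrightarrow> (A * K - A * L) $$ (i, j) = 0" by simp
  then show ?thesis
    using A K L by (intro eq_matI) auto
qed

section \<open>Existence and uniqueness of the pseudo-inverse\<close>

text \<open>Cancelling the leading A' in \<open>GG\<close> gives PA = A for P = AGA'. Its adjoint is
  A'P' = A', so PP' = AGA'P' = P, and PP' is Hermitian.\<close>

lemma gram_inner_inverse:
  fixes A :: "complex mat"
  assumes A: "A \<in> carrier_mat n m" and G: "G \<in> carrier_mat m m"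
    and GG: "mat_adjoint A * A * G * (mat_adjoint A * A) = mat_adjoint A * A"
  shows "A * G * mat_adjoint A * A = A"
    and "mat_adjoint A * (A * G * mat_adjoint A) = mat_adjoint A"
    and "mat_adjoint (A * G * mat_adjoint A) = A * G * mat_adjoint A"
proof -
  let ?P = "A * G * mat_adjoint A"
  have "mat_adjoint A * (A * (G * mat_adjoint A * A)) = mat_adjoint A * (A * 1\<^sub>m m)"
    using GG A G by (simp add: mult_mat_assoc)
  then have "A * (G * mat_adjoint A * A) = A * 1\<^sub>m m"
    using A G by (intro mat_adjoint_cancel[OF A]) auto
  then show PA: "?P * A = A"
    using A G by (simp add: mult_mat_assoc)
  have adj: "mat_adjoint A * mat_adjoint ?P = mat_adjoint A"
    using PA A G mat_adjoint_mult[of ?P A] by simp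
  have "?P * mat_adjoint ?P = A * G * (mat_adjoint A * mat_adjoint ?P)"
    using A G by (intro mult_mat_assoc) auto
  \<comment> \<open>Hence \<open>?P\<close> is Hermitian even if \<open>G\<close> is not.\<close>
  then have PP: "?P * mat_adjoint ?P = ?P" by (simp add: adj)
  have "mat_adjoint (?P * mat_adjoint ?P) = ?P * mat_adjoint ?P"
    using A G mat_adjoint_mult[of ?P "mat_adjoint ?P"] by simp
  then show herm: "mat_adjoint ?P = ?P" by (simp add: PP)
  show "mat_adjoint A * ?P = mat_adjoint A"
    using adj by (simp add: herm)
qed

text \<open>Inserting A = ACA gives BA = (BA)(CA). Both factors are Hermitian, so taking adjoints
  reverses their order, and (CA)(BA) collapses to CA by ABA = A. Likewise AB = AC, and then B = BAB
  = CAB = CAC = C.\<close>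

lemma is_pinv_unique:
  assumes B: "is_pinv A B" and C: "is_pinv A C"
  shows "B = C"
proof -
  note b = B[unfolded is_pinv_def] and c = C[unfolded is_pinv_def]
  have dims: "dim_row B = dim_col A" "dim_col B = dim_row A"
    "dim_row C = dim_col A" "dim_col C = dim_row A"
    using b c by auto
  have "B * A = B * (A * C * A)" using c by simp
  also have "\<dots> = (B * A) * (C * A)"
    using dims by (simp add: mult_mat_assoc)
  also have "\<dots> = mat_adjoint (B * A) * mat_adjoint (C * A)"
    using b c by simp
  also have "\<dots> = mat_adjoint (C * (A * B * A))"
    using dims by (subst mat_adjoint_mult[symmetric]) (simp_all add: mult_mat_assoc)
  also have "\<dots> = C * A" using b c by simp
  finally have BA: "B * A = C * A" .
  have "A * B = (A * C * A) * B" using c by simp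
  also have "\<dots> = (A * C) * (A * B)"
    using dims by (simp add: mult_mat_assoc)
  also have "\<dots> = mat_adjoint (A * C) * mat_adjoint (A * B)"
    using b c by simp
  also have "\<dots> = mat_adjoint ((A * B * A) * C)"
    using dims by (subst mat_adjoint_mult[symmetric]) (simp_all add: mult_mat_assoc)
  also have "\<dots> = A * C" using b c by simp
  finally have AB: "A * B = A * C" .
  have "B = B * A * B" using b by simp
  also have "\<dots> = C * (A * B)" using dims by (simp add: BA mult_mat_assoc)
  also have "\<dots> = C * A * C" using dims by (simp add: AB mult_mat_assoc)
  also have "\<dots> = C" using c by simp
  finally show ?thesis .
qed

lemma pinv_eqI: "is_pinv A B \<Longrightarrow> pinv A = B"
  unfolding pinv_def by (rule the_equality) (auto intro: is_pinv_unique)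

lemma is_pinv_exists: "\<exists>B. is_pinv A B"
proof -
  define n m where "n = dim_row A" and "m = dim_col A"
  have A: "A \<in> carrier_mat n m" and A': "mat_adjoint A \<in> carrier_mat m n"
    by (auto simp: n_def m_def)
  obtain G where G: "G \<in> carrier_mat m m"
    "mat_adjoint A * A * G * (mat_adjoint A * A) = mat_adjoint A * A"
    using inner_inverse_exists[of "mat_adjoint A * A" m m] A by auto
  \<comment> \<open>The double adjoints let \<open>gram_inner_inverse\<close> apply verbatim to A'
    in place of \<open>A\<close>.\<close>
  obtain F where F: "F \<in> carrier_mat n n"
    "mat_adjoint (mat_adjoint A) * mat_adjoint A * F * (mat_adjoint (mat_adjoint A) * mat_adjoint A)
      = mat_adjoint (mat_adjoint A) * mat_adjoint A"
    using inner_inverse_exists[of "A * mat_adjoint A" n n] A by auto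
  define P where "P = A * G * mat_adjoint A"
  define Q where "Q = mat_adjoint A * F * A"
  have P: "P * A = A" "mat_adjoint P = P"
    using gram_inner_inverse[OF A G] by (simp_all add: P_def)
  have Q: "A * Q = A" "mat_adjoint Q = Q"
    using gram_inner_inverse[OF A' F] by (simp_all add: Q_def)
  define L where "L = mat_adjoint A * F"
  define R where "R = G * mat_adjoint A"
  have dims: "dim_row L = m" "dim_col L = n" "dim_row R = m" "dim_col R = n"
    "dim_row A = n" "dim_col A = m"
    using A F G by (auto simp: L_def R_def)
  have LA: "L * A = Q" and AR: "A * R = P"
    using A F G by (simp_all add: L_def R_def P_def Q_def mult_mat_assoc)
  \<comment> \<open>The two outer factors are one-sided: \<open>L * A = Q\<close> and
    \<open>A * R = P\<close>. Thus \<open>A * B = A * Q * R = A * R = P\<close> and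
    \<open>B * A = L * P * A = L * A = Q\<close>, both Hermitian.\<close>
  define B where "B = L * A * R"
  have AB: "A * B = P"
  proof -
    have "A * B = (A * Q) * R"
      using dims LA[symmetric] by (simp add: B_def mult_mat_assoc)
    then show ?thesis by (simp add: Q AR)
  qed
  have BA: "B * A = Q"
  proof -
    have "B * A = L * (P * A)"
      using dims AR[symmetric] by (simp add: B_def mult_mat_assoc)
    then show ?thesis by (simp add: P LA)
  qed
  have "B * A * B = L * A * B" by (simp add: BA LA)
  also have "\<dots> = L * (A * B)"
    using dims by (intro mult_mat_assoc) (simp_all add: B_def)
  also have "\<dots> = B"
    unfolding AB unfolding AR[symmetric] B_def using dims by (simp add: mult_mat_assoc)
  finally have BAB: "B * A * B = B" .
  have "B \<in> carrier_mat m n"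
    unfolding B_def using dims by (intro carrier_matI) auto
  with BAB dims have "is_pinv A B"
    by (simp add: is_pinv_def AB BA P Q)
  then show ?thesis ..
qed

lemma is_pinv_pinv: "is_pinv A (pinv A)"
  using is_pinv_exists[of A] pinv_eqI[of A] by metis

lemma pinv_carrier: "A \<in> carrier_mat n m \<Longrightarrow> pinv A \<in> carrier_mat m n"
  using is_pinv_pinv[of A] by (auto simp: is_pinv_def)

lemma mult_pinv_mult: "A * pinv A * A = A"
  and pinv_mult_pinv: "pinv A * A * pinv A = pinv A"
  and mult_pinv_hermitian: "mat_adjoint (A * pinv A) = A * pinv A"
  and pinv_mult_hermitian: "mat_adjoint (pinv A * A) = pinv A * A"
  using is_pinv_pinv[of A] by (auto simp: is_pinv_def)

section \<open>Orthogonal projections onto complements of images and kernels\<close>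

lemma herm_complement_minus_closed:
  assumes S: "S \<subseteq> carrier_vec n" and u: "u \<in> herm_complement n S" and v: "v \<in> herm_complement n S"
  shows "u - v \<in> herm_complement n S"
proof -
  have c: "u \<in> carrier_vec n" "v \<in> carrier_vec n"
    using u v by (auto simp: herm_complement_def)
  have "(u - v) \<bullet>c w = 0" if w: "w \<in> S" for w
  proof -
    have "conjugate w \<in> carrier_vec n" using w S by auto
    from minus_scalar_prod_distrib[OF c this] show ?thesis
      using u v w by (simp add: herm_complement_def)
  qed
  then show ?thesis using c by (simp add: herm_complement_def)
qed

text \<open>The difference Pv - Qv lies in R, and as (v - Qv) - (v - Pv) it also lies in the
  complement of R, so it is orthogonal to itself. Taking R as an orthogonal complement guarantees
  closure under subtraction.\<close>

lemma is_orth_proj_unique: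
  assumes S: "S \<subseteq> carrier_vec n"
    and P: "is_orth_proj n (herm_complement n S) P"
    and Q: "is_orth_proj n (herm_complement n S) Q"
  shows "P = Q"
proof (rule eq_matI)
  let ?R = "herm_complement n S"
  have R: "?R \<subseteq> carrier_vec n" by (auto simp: herm_complement_def)
  have PQ: "P \<in> carrier_mat n n" "Q \<in> carrier_mat n n"
    using P Q by (auto simp: is_orth_proj_def)
  then show "dim_row P = dim_row Q" "dim_col P = dim_col Q" by auto
  fix i j assume "i < dim_row Q" "j < dim_col Q"
  then have ij: "i < n" "j < n" using PQ by auto
  \<comment> \<open>On this unit vector \<open>P\<close> and \<open>Q\<close> return their columns
    \<open>j\<close>, so agreement here gives agreement of entries.\<close>
  define v :: "complex vec" where "v = unit_vec n j"
  have v: "v \<in> carrier_vec n" by (simp add: v_def)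
  define u where "u = P *\<^sub>v v - Q *\<^sub>v v"
  have Pv: "P *\<^sub>v v \<in> ?R" "v - P *\<^sub>v v \<in> herm_complement n ?R"
    and Qv: "Q *\<^sub>v v \<in> ?R" "v - Q *\<^sub>v v \<in> herm_complement n ?R"
    using P Q v by (auto simp: is_orth_proj_def)
  have carr: "P *\<^sub>v v \<in> carrier_vec n" "Q *\<^sub>v v \<in> carrier_vec n"
    using PQ v by auto
  have uR: "u \<in> ?R"
    unfolding u_def by (rule herm_complement_minus_closed[OF S Pv(1) Qv(1)])
  have "a - b = (v - b) - (v - a)" if "a \<in> carrier_vec n" "b \<in> carrier_vec n" for a b
    using that v by (intro eq_vecI) auto
  from this[OF carr] have "u = (v - Q *\<^sub>v v) - (v - P *\<^sub>v v)"
    by (simp only: u_def)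
  then have "u \<in> herm_complement n ?R"
    using herm_complement_minus_closed[OF R Qv(2) Pv(2)] by simp
  with uR have "u \<bullet>c u = 0" "u \<in> carrier_vec n"
    by (auto simp: herm_complement_def)
  then have "u = 0\<^sub>v n" by (simp add: conjugate_square_eq_0_vec[of _ n])
  then have "u $ i = 0" using ij by simp
  then have "(P *\<^sub>v v) $ i = (Q *\<^sub>v v) $ i"
    using PQ ij by (simp add: u_def del: index_mult_mat_vec)
  then show "P $$ (i, j) = Q $$ (i, j)"
    using PQ ij by (simp add: v_def)
qed

text \<open>Membership of v - Pv in \<open>S\<close> suffices because \<open>S\<close> is contained
  in its double complement. All projections below are identified by this criterion.\<close>

lemma orth_proj_herm_complement_eqI:
  assumes S: "S \<subseteq> carrier_vec n" and P: "P \<in> carrier_mat n n"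
    and range: "\<And>v. v \<in> carrier_vec n \<Longrightarrow> P *\<^sub>v v \<in> herm_complement n S"
    and compl: "\<And>v. v \<in> carrier_vec n \<Longrightarrow> v - P *\<^sub>v v \<in> S"
  shows "orth_proj n (herm_complement n S) = P"
proof -
  have proj: "is_orth_proj n (herm_complement n S) P"
    unfolding is_orth_proj_def
  proof (intro conjI ballI P range)
    fix v :: "complex vec" assume v: "v \<in> carrier_vec n"
    have "(v - P *\<^sub>v v) \<bullet>c w = 0" if w: "w \<in> herm_complement n S" for w
    proof -
      have c: "w \<in> carrier_vec n" "v - P *\<^sub>v v \<in> carrier_vec n"
        using w compl[OF v] S by (auto simp: herm_complement_def)
      have "w \<bullet>c (v - P *\<^sub>v v) = 0"
        using w compl[OF v] by (auto simp: herm_complement_def)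
      then show ?thesis by (rule cscalar_prod_zero_sym[OF c])
    qed
    then show "v - P *\<^sub>v v \<in> herm_complement n (herm_complement n S)"
      using compl[OF v] S by (auto simp: herm_complement_def)
  qed
  then show ?thesis
    unfolding orth_proj_def by (rule the_equality) (rule is_orth_proj_unique[OF S _ proj])
qed

lemma mat_image_iff:
  "Z \<in> carrier_mat n k \<Longrightarrow> w \<in> mat_image Z \<longleftrightarrow> (\<exists>v \<in> carrier_vec k. w = Z *\<^sub>v v)"
  by (auto simp: mat_image_def)

lemma mat_image_carrier: "Z \<in> carrier_mat n k \<Longrightarrow> mat_image Z \<subseteq> carrier_vec n"
  by (auto simp: mat_image_iff)

text \<open>Moving \<open>Z\<close> across the inner product turns pairing with \<open>Z u\<close>
  into pairing Z'v = 0 with \<open>u\<close>.\<close>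

lemma herm_complement_mat_image:
  assumes Z: "Z \<in> carrier_mat n k" and v: "v \<in> carrier_vec n"
    and 0: "mat_adjoint Z *\<^sub>v v = 0\<^sub>v k"
  shows "v \<in> herm_complement n (mat_image Z)"
proof -
  have "v \<bullet>c (Z *\<^sub>v u) = 0" if u: "u \<in> carrier_vec k" for u
    using cscalar_prod_mult_mat_vec[of "mat_adjoint Z" k n v u] Z v u 0 by simp
  then show ?thesis
    using v by (auto simp: herm_complement_def mat_image_iff[OF Z])
qed

text \<open>The pseudo-inverse of Z'Z is in particular an inner inverse, so Z'Q = Z'. Hence v - Qv
  is killed by Z', while Qv visibly lies in the image of \<open>Z\<close>. The columns of
  \<open>Z\<close> may be dependent.\<close>

lemma orth_proj_complement_mat_image:
  assumes Z: "Z \<in> carrier_mat n k"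
  shows "orth_proj n (herm_complement n (mat_image Z))
    = 1\<^sub>m n - Z * pinv (mat_adjoint Z * Z) * mat_adjoint Z" (is "_ = 1\<^sub>m n - ?Q")
proof -
  let ?G = "pinv (mat_adjoint Z * Z)"
  have G: "?G \<in> carrier_mat k k" using Z by (intro pinv_carrier) simp
  have Q: "?Q \<in> carrier_mat n n" using Z G by simp
  have ZQ: "mat_adjoint Z * ?Q = mat_adjoint Z"
    by (rule gram_inner_inverse[OF Z G mult_pinv_mult])
  have mult: "(1\<^sub>m n - ?Q) *\<^sub>v v = v - ?Q *\<^sub>v v" if "v \<in> carrier_vec n" for v
    using Q that by (simp add: minus_mult_distrib_mat_vec[of _ n n])
  show ?thesis
  proof (rule orth_proj_herm_complement_eqI[OF mat_image_carrier[OF Z]])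
    fix v :: "complex vec" assume v: "v \<in> carrier_vec n"
    have Qv: "?Q *\<^sub>v v \<in> carrier_vec n" using Q v by simp
    have "mat_adjoint Z *\<^sub>v (v - ?Q *\<^sub>v v) = mat_adjoint Z *\<^sub>v v - (mat_adjoint Z * ?Q) *\<^sub>v v"
      using Z Q v Qv
      by (simp add: mult_minus_distrib_mat_vec[of _ k n] assoc_mult_mat_vec[of _ k n _ n])
    also have "\<dots> = 0\<^sub>v k" unfolding ZQ using Z v by simp
    finally show "(1\<^sub>m n - ?Q) *\<^sub>v v \<in> herm_complement n (mat_image Z)"
      unfolding mult[OF v] using Z v Qv by (intro herm_complement_mat_image) auto
    have "v - (1\<^sub>m n - ?Q) *\<^sub>v v = ?Q *\<^sub>v v"
      unfolding mult[OF v] using v Qv by (intro eq_vecI) auto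
    also have "\<dots> = Z *\<^sub>v (?G *\<^sub>v (mat_adjoint Z *\<^sub>v v))"
      using Z G v by (simp add: assoc_mult_mat_vec[of _ n k _ n] assoc_mult_mat_vec[of _ k k _ n])
    finally show "v - (1\<^sub>m n - ?Q) *\<^sub>v v \<in> mat_image Z"
      unfolding mat_image_iff[OF Z]
      by (rule bexI) (use Z G v in \<open>auto intro!: mult_mat_vec_carrier\<close>)
  qed (use Q in \<open>auto intro: minus_carrier_mat\<close>)
qed

text \<open>M^+ M is Hermitian and kills ker M, so its values are orthogonal to ker M; M M^+ M = M
  puts v - M^+ M v into ker M.\<close>

lemma orth_proj_complement_kernel:
  assumes M: "M \<in> carrier_mat m n"
  shows "orth_proj n (herm_complement n (mat_kernel M)) = pinv M * M" (is "_ = ?P")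
proof (rule orth_proj_herm_complement_eqI)
  note B = pinv_carrier[OF M]
  show "mat_kernel M \<subseteq> carrier_vec n" using M by (auto simp: mat_kernel_def)
  show P: "?P \<in> carrier_mat n n" using M B by simp
  fix v :: "complex vec" assume v: "v \<in> carrier_vec n"
  have "(?P *\<^sub>v v) \<bullet>c w = 0" if w: "w \<in> mat_kernel M" for w
  proof -
    have wc: "w \<in> carrier_vec n" "M *\<^sub>v w = 0\<^sub>v m" using w M by (auto simp: mat_kernel_def)
    have "(?P *\<^sub>v v) \<bullet>c w = v \<bullet>c (?P *\<^sub>v w)"
      using cscalar_prod_mult_mat_vec[OF P v wc(1)] by (simp add: pinv_mult_hermitian)
    also have "?P *\<^sub>v w = 0\<^sub>v n"
      using M B wc by (simp add: assoc_mult_mat_vec[of _ n m _ n]) (auto intro!: eq_vecI)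
    finally show ?thesis using v by simp
  qed
  then show "?P *\<^sub>v v \<in> herm_complement n (mat_kernel M)"
    using P v by (simp add: herm_complement_def)
  have "M *\<^sub>v (v - ?P *\<^sub>v v) = M *\<^sub>v v - (M * ?P) *\<^sub>v v"
    using M P v by (simp add: mult_minus_distrib_mat_vec[of _ m n] assoc_mult_mat_vec[of _ m n _ n])
  also have "M * ?P = M"
    using M B mult_pinv_mult[of M] by (simp add: mult_mat_assoc)
  finally show "v - ?P *\<^sub>v v \<in> mat_kernel M"
    using M P v by (simp add: mat_kernel_def)
qed

text \<open>The double complement arises because \<open>YY\<close> is itself a complement. The
  criterion is applied with S = im(M)^perp: M M^+ v lies in im M, hence in the complement of S, and
  v - M M^+ v lies in S.\<close>

lemma orth_proj_double_complement_mat_image: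
  assumes M: "M \<in> carrier_mat m n"
  shows "orth_proj m (herm_complement m (herm_complement m (mat_image M))) = M * pinv M"
    (is "_ = ?P")
proof (rule orth_proj_herm_complement_eqI)
  note B = pinv_carrier[OF M]
  show "herm_complement m (mat_image M) \<subseteq> carrier_vec m" by (auto simp: herm_complement_def)
  show P: "?P \<in> carrier_mat m m" using M B by simp
  fix v :: "complex vec" assume v: "v \<in> carrier_vec m"
  have Pv: "?P *\<^sub>v v = M *\<^sub>v (pinv M *\<^sub>v v)"
    using M B v by (simp add: assoc_mult_mat_vec[of _ m n _ m])
  \<comment> \<open>This is the adjoint of M M^+ M = M, with M M^+ Hermitian.\<close>
  have adjP: "mat_adjoint M * ?P = mat_adjoint M"
    using mat_adjoint_mult[of ?P M] M B by (simp add: mult_pinv_mult mult_pinv_hermitian)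
  have "(?P *\<^sub>v v) \<bullet>c w = 0" if w: "w \<in> herm_complement m (mat_image M)" for w
  proof -
    have wc: "w \<in> carrier_vec m" using w by (simp add: herm_complement_def)
    have "?P *\<^sub>v v \<in> mat_image M"
      unfolding mat_image_iff[OF M] using Pv by (rule bexI) (rule mult_mat_vec_carrier[OF B v])
    then have "w \<bullet>c (?P *\<^sub>v v) = 0"
      using w by (simp add: herm_complement_def)
    then show ?thesis
      using P v wc by (intro cscalar_prod_zero_sym[of w m]) auto
  qed
  then show "?P *\<^sub>v v \<in> herm_complement m (herm_complement m (mat_image M))"
    using P v by (simp add: herm_complement_def)
  have "mat_adjoint M *\<^sub>v (v - ?P *\<^sub>v v) = mat_adjoint M *\<^sub>v v - (mat_adjoint M * ?P) *\<^sub>v v"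
    using M P v by (simp add: mult_minus_distrib_mat_vec[of _ n m] assoc_mult_mat_vec[of _ n m _ m])
  also have "\<dots> = 0\<^sub>v n" unfolding adjP using M v by simp
  finally show "v - ?P *\<^sub>v v \<in> herm_complement m (mat_image M)"
    using M P v by (intro herm_complement_mat_image) auto
qed

section \<open>The outer inverse \<open>M\<close> of \<open>A\<close> and its pseudo-inverse\<close>

text \<open>With N = BUDVB, the relation BAB = B gives NAB = BAN = N, and the inner product of
  factors in NAN is D(VBU)D = D, so NAN = N. Then (B - N)A(B - N) = B - N - N + N = B - N.\<close>

lemma mult_minus_outer_inverse:
  fixes A B U V D :: "'a :: comm_ring_1 mat"
  assumes A: "A \<in> carrier_mat n m" and B: "B \<in> carrier_mat m n"
    and U: "U \<in> carrier_mat n p" and V: "V \<in> carrier_mat q m" and D: "D \<in> carrier_mat p q"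
    and BAB: "B * A * B = B" and DCD: "D * (V * B * U) * D = D"
    and M: "M = B - B * U * D * V * B"
  shows "M * A * M = M"
proof -
  define N where "N = B * U * D * V * B"
  have N: "N \<in> carrier_mat m n" unfolding N_def using B by (intro carrier_matI) auto
  \<comment> \<open>A trailing factor \<open>Z\<close> lets the relation fire inside right-nested
    products; the same holds for \<open>DCD'\<close>.\<close>
  have BAB': "B * (A * (B * Z)) = B * Z" if "dim_row Z = n" for Z
    using arg_cong[OF BAB, of "\<lambda>T. T * Z"] A B that by (simp add: mult_mat_assoc)
  have DCD': "D * (V * (B * (U * (D * Z)))) = D * Z" if "dim_row Z = q" for Z
    using arg_cong[OF DCD, of "\<lambda>T. T * Z"] B U V D that by (simp add: mult_mat_assoc)
  have NAB: "N * A * B = N"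
    using A B U V D BAB by (simp add: N_def mult_mat_assoc)
  have BAN: "B * A * N = N"
    using A B U V D by (simp add: N_def mult_mat_assoc BAB')
  have NAN: "N * A * N = N"
    using A B U V D by (simp add: N_def mult_mat_assoc BAB' DCD')
  have "M * A * M = (B * A - N * A) * (B - N)"
    unfolding M N_def[symmetric] using A B N by (simp add: minus_mult_distrib_mat[of _ m n])
  also have "\<dots> = (B * A * B - N * A * B) - (B * A * N - N * A * N)"
    using A B N
    by (simp add: mult_minus_distrib_mat[of _ m m _ n] minus_mult_distrib_mat[of _ m m]
        minus_carrier_mat)
  also have "\<dots> = M"
    unfolding BAB NAB BAN NAN M N_def[symmetric] using B N by (intro eq_matI) auto
  finally show ?thesis .
qed

theorem mainTheorem2:
  fixes A X Y M Xh Yh :: "complex mat"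
    and n m p q r s :: nat
    and XX YY :: "complex vec set"
  assumes A: "A \<in> carrier_mat n m"
    and X: "X \<in> carrier_mat n p"
    and Y: "Y \<in> carrier_mat m q"
    and M: "M = pinv A - pinv A * X * pinv (mat_adjoint Y * pinv A * X) * mat_adjoint Y * pinv A"
    and XX: "XX = mat_kernel M"
    and YY: "YY = herm_complement m (mat_image M)"
    and Xh: "Xh \<in> carrier_mat n r" "mat_image Xh = XX"
    and Yh: "Yh \<in> carrier_mat m s" "mat_image Yh = YY"
  shows "pinv M = orth_proj n (herm_complement n XX) * A * orth_proj m (herm_complement m YY)
    \<and> orth_proj n (herm_complement n XX) = 1\<^sub>m n - Xh * pinv (mat_adjoint Xh * Xh) * mat_adjoint Xh
    \<and> orth_proj m (herm_complement m YY) = 1\<^sub>m m - Yh * pinv (mat_adjoint Yh * Yh) * mat_adjoint Yh"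
proof (intro conjI)
  note B = pinv_carrier[OF A]
  have Y': "mat_adjoint Y \<in> carrier_mat q m" using Y by simp
  have D: "pinv (mat_adjoint Y * pinv A * X) \<in> carrier_mat p q"
    using B X Y' by (intro pinv_carrier) simp
  have Mc: "M \<in> carrier_mat m n" unfolding M using B by (intro carrier_matI) auto
  \<comment> \<open>The two uses of \<open>pinv_mult_pinv\<close> are for \<open>A\<close> and for
    Y'A^+ X, the matrix whose pseudo-inverse plays the part of \<open>D\<close>.\<close>
  have MAM: "M * A * M = M"
    by (rule mult_minus_outer_inverse[OF A B X Y' D pinv_mult_pinv pinv_mult_pinv M])
  note K = pinv_carrier[OF Mc]
  have "pinv M * M * A * (M * pinv M) = pinv M * (M * A * M) * pinv M"
    using A Mc K by (simp add: mult_mat_assoc)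
  also have "\<dots> = pinv M" by (simp add: MAM pinv_mult_pinv)
  finally show "pinv M = orth_proj n (herm_complement n XX) * A * orth_proj m (herm_complement m YY)"
    unfolding XX YY orth_proj_complement_kernel[OF Mc]
      orth_proj_double_complement_mat_image[OF Mc] ..
  show "orth_proj n (herm_complement n XX) = 1\<^sub>m n - Xh * pinv (mat_adjoint Xh * Xh) * mat_adjoint Xh"
    using orth_proj_complement_mat_image[OF Xh(1)] by (simp add: Xh(2))
  show "orth_proj m (herm_complement m YY) = 1\<^sub>m m - Yh * pinv (mat_adjoint Yh * Yh) * mat_adjoint Yh"
    using orth_proj_complement_mat_image[OF Yh(1)] by (simp add: Yh(2))
qed

end
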